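(* A groupoid $S$ is an AG-group if and only if $S$ is a left simple AG-groupoid with a left identity element.
   Context: A groupoid is a set with a binary operation. An AG-groupoid is a groupoid satisfying $(xy)z=(zy)x$. A left identity is an element $e$ with $ex=x$ for all $x$. An AG-group is an AG-groupoid with a left identity $e$ in which for every element $a$ there exists an element $a^*$ with $a^*a=e$. A left ideal of a groupoid $S$ is a subset $I\subseteq S$ with $SI\subseteq I$; $S$ is left simple if its only nonempty left ideal is $S$ itself. *)

theory Defs
  imports Main
begin

text \<open>
  Groupoid is meant in the sense of magma. A structure is given by a carrier set \<open>S\<close> and an
  operation \<open>m\<close>, whose values outside the carrier are irrelevant.
\<close>

definition groupoid :: "'a set \<Rightarrow> ('a \<Rightarrow> 'a \<Rightarrow> 'a) \<Rightarrow> bool" where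
  "groupoid S m \<longleftrightarrow> (\<forall>x\<in>S. \<forall>y\<in>S. m x y \<in> S)"

definition ag_groupoid :: "'a set \<Rightarrow> ('a \<Rightarrow> 'a \<Rightarrow> 'a) \<Rightarrow> bool" where
  "ag_groupoid S m \<longleftrightarrow>
     groupoid S m \<and> (\<forall>x\<in>S. \<forall>y\<in>S. \<forall>z\<in>S. m (m x y) z = m (m z y) x)"

definition left_identity :: "'a set \<Rightarrow> ('a \<Rightarrow> 'a \<Rightarrow> 'a) \<Rightarrow> 'a \<Rightarrow> bool" where
  "left_identity S m e \<longleftrightarrow> e \<in> S \<and> (\<forall>x\<in>S. m e x = x)"

definition ag_group :: "'a set \<Rightarrow> ('a \<Rightarrow> 'a \<Rightarrow> 'a) \<Rightarrow> bool" where
  "ag_group S m \<longleftrightarrow>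
     ag_groupoid S m \<and> (\<exists>e. left_identity S m e \<and> (\<forall>a\<in>S. \<exists>a'\<in>S. m a' a = e))"

definition left_ideal :: "'a set \<Rightarrow> ('a \<Rightarrow> 'a \<Rightarrow> 'a) \<Rightarrow> 'a set \<Rightarrow> bool" where
  "left_ideal S m I \<longleftrightarrow> I \<subseteq> S \<and> {m s x | s x. s \<in> S \<and> x \<in> I} \<subseteq> I"

text \<open>The empty groupoid counts as left simple; no nonemptiness of \<open>S\<close> is imposed here.\<close>

definition left_simple :: "'a set \<Rightarrow> ('a \<Rightarrow> 'a \<Rightarrow> 'a) \<Rightarrow> bool" where
  "left_simple S m \<longleftrightarrow> (\<forall>I. left_ideal S m I \<and> I \<noteq> {} \<longrightarrow> I = S)"

end

theory Submission
  imports Defs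
begin

text \<open>
  In an AG-groupoid with left identity \<open>e\<close>, right multiplication by \<open>e\<close> is an involution:
  \<open>(xe)e = (ee)x = x\<close>. Hence a left ideal containing \<open>e\<close> contains every \<open>x = (xe)e\<close>. In an
  AG-group every nonempty left ideal contains \<open>e = a\<^sup>*a\<close> for one of its elements \<open>a\<close>, so it is
  everything. Conversely, the involution also shows that the set \<open>Sa\<close> of left multiples of \<open>a\<close>
  is a left ideal, as \<open>s(xa) = ((se)x)a\<close>. Left simplicity then gives
  \<open>Sa = S\<close>, and \<open>e \<in> Sa\<close> says that \<open>a\<close> has a left inverse.
\<close>

lemma ag_groupoid_closed:
  assumes "ag_groupoid S m" "x \<in> S" "y \<in> S"
  shows "m x y \<in> S"
  using assms unfolding ag_groupoid_def groupoid_def by blast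

lemma left_invertive:
  assumes "ag_groupoid S m" "x \<in> S" "y \<in> S" "z \<in> S"
  shows "m (m x y) z = m (m z y) x"
  using assms unfolding ag_groupoid_def by blast

lemma right_mult_left_identity_involution:
  assumes "ag_groupoid S m" "left_identity S m e" "x \<in> S"
  shows "m (m x e) e = x"
  using assms left_invertive[of S m x e e] unfolding left_identity_def by simp

text \<open>
  The substitute for associativity that keeps the rightmost factor in place: replacing \<open>s\<close> by
  \<open>(se)e\<close> makes the left side a product to which the left invertive law applies.
\<close>

lemma left_identity_reassociate:
  assumes ag: "ag_groupoid S m" and e: "left_identity S m e"
    and s: "s \<in> S" and x: "x \<in> S" and a: "a \<in> S"
  shows "m s (m x a) = m (m (m s e) x) a"
proof -
  have eS: "e \<in> S" using e unfolding left_identity_def by blast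
  note closed = ag_groupoid_closed[OF ag] and inv = left_invertive[OF ag]
  have "m s (m x a) = m (m (m s e) e) (m x a)"
    using right_mult_left_identity_involution[OF ag e s] by simp
  also have "\<dots> = m (m (m x a) e) (m s e)"
    by (intro inv closed s x a eS)
  also have "m (m x a) e = m (m e a) x"
    by (intro inv x a eS)
  also have "m e a = a"
    using e a unfolding left_identity_def by blast
  also have "m (m a x) (m s e) = m (m (m s e) x) a"
    by (intro inv closed s x a eS)
  finally show ?thesis .
qed

lemma left_multiples_left_ideal:
  assumes ag: "ag_groupoid S m" and e: "left_identity S m e" and a: "a \<in> S"
  shows "left_ideal S m {m x a | x. x \<in> S}"
proof -
  have eS: "e \<in> S" using e unfolding left_identity_def by blast
  have "m s (m x a) \<in> {m x a | x. x \<in> S}" if "s \<in> S" "x \<in> S" for s x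
    using left_identity_reassociate[OF ag e that a] ag_groupoid_closed[OF ag] that eS by blast
  then show ?thesis
    using ag_groupoid_closed[OF ag _ a] unfolding left_ideal_def by blast
qed

lemma left_ideal_containing_left_identity:
  assumes ag: "ag_groupoid S m" and e: "left_identity S m e"
    and I: "left_ideal S m I" and eI: "e \<in> I"
  shows "I = S"
proof
  show "I \<subseteq> S" using I unfolding left_ideal_def by blast
  show "S \<subseteq> I"
  proof
    fix x assume x: "x \<in> S"
    have "m x e \<in> S"
      using ag_groupoid_closed[OF ag x] e unfolding left_identity_def by blast
    then have "m (m x e) e \<in> I"
      using I eI unfolding left_ideal_def by blast
    then show "x \<in> I"
      using right_mult_left_identity_involution[OF ag e x] by simp
  qed
qed

theorem corollary9:
  fixes S :: "'a set" and m :: "'a \<Rightarrow> 'a \<Rightarrow> 'a"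
  assumes "groupoid S m"
  shows "ag_group S m \<longleftrightarrow>
    left_simple S m \<and> ag_groupoid S m \<and> (\<exists>e. left_identity S m e)"
proof
  assume "ag_group S m"
  then obtain e where ag: "ag_groupoid S m" and e: "left_identity S m e"
    and inverse: "\<forall>a\<in>S. \<exists>a'\<in>S. m a' a = e"
    unfolding ag_group_def by blast
  have "I = S" if I: "left_ideal S m I" and "I \<noteq> {}" for I
  proof -
    obtain a where a: "a \<in> I" using \<open>I \<noteq> {}\<close> by blast
    then have "a \<in> S" using I unfolding left_ideal_def by blast
    then obtain a' where "a' \<in> S" "m a' a = e" using inverse by blast
    then have "e \<in> I" using I a unfolding left_ideal_def by blast
    then show ?thesis by (rule left_ideal_containing_left_identity[OF ag e I])
  qed
  then show "left_simple S m \<and> ag_groupoid S m \<and> (\<exists>e. left_identity S m e)"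
    using ag e unfolding left_simple_def by blast
next
  assume "left_simple S m \<and> ag_groupoid S m \<and> (\<exists>e. left_identity S m e)"
  then obtain e where simple: "left_simple S m" and ag: "ag_groupoid S m"
    and e: "left_identity S m e"
    by blast
  have eS: "e \<in> S" using e unfolding left_identity_def by blast
  have "\<exists>a'\<in>S. m a' a = e" if a: "a \<in> S" for a
  proof -
    have "{m x a | x. x \<in> S} \<noteq> {}" using a by blast
    then have "{m x a | x. x \<in> S} = S"
      using simple left_multiples_left_ideal[OF ag e a] unfolding left_simple_def by blast
    then have "e \<in> {m x a | x. x \<in> S}" using eS by simp
    then show ?thesis by auto
  qed
  then show "ag_group S m"
    using ag e unfolding ag_group_def by blast
qed

end
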